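(* Let $1\le d_f<\infty$ and $2\le d_w<\infty$. Let $\{(G^{(N)},\mu^{(N)})\}_{N\ge 1}$ be finite weighted graphs with $\sharp V(G^{(N)})\to\infty$ which satisfy the uniform weight conditions with exponent $d_f$ (with volume constant $c_{\rm v}$) and the uniform parabolic Harnack inequality $\mathrm{UPHI}(d_w)$. Put $R_N=\mathrm{diam}\{G^{(N)}\}$, $T_N=(R_N)^{d_w}$, and let $\tilde c<\infty$ be a constant with $\tilde c^{-1}\le\mu^{(N)}_x\le\tilde c$ for all $N$ and $x\in V(G^{(N)})$. Then there are finite $c_1$, $N_1$ such that for every integer $t\ge0$ and every $N\ge N_1$, $$\max_{\mathbf{x}\in V(\mathbb{Z}_2\wr G^{(N)})}\big\|P^*_t(\mathbf{x},\cdot\,;G^{(N)})-\pi^*(\cdot\,;G^{(N)})\big\|_{\rm TV}\ge c_1^{-1}e^{-c_1t/T_N}-\tilde c\,c_{\rm v}\,R_N^{-d_f}.$$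
   Context: Graphs $G=(V(G),E(G))$ are connected, with graph distance $d$, balls $B(x,r)=\{y: d(x,y)\le r\}$, and diameter $\mathrm{diam}\{G\}$. A weighted graph $(G,\mu)$ is a graph with a symmetric function $\mu:V(G)\times V(G)\to[0,\infty)$, $\mu_{xy}=\mu_{yx}$, with $\mu_{xy}>0$ iff $xy\in E(G)$. Put $\mu_x=\sum_{y:xy\in E(G)}\mu_{xy}$, $\mu(A)=\sum_{x\in A}\mu_x$, $V(x,r)=\mu(B(x,r))$. The random walk on $(G,\mu)$ has transition matrix $P(x,y)=\mu_{xy}/\mu_x$; the lazy random walk $\tilde X$ has $\tilde P(x,y)=\frac12P(x,y)$ for $x\ne y$ and $\tilde P(x,x)=\frac12$. A superscript $(N)$ denotes objects on $(G^{(N)},\mu^{(N)})$. $\sharp A$ is the cardinality of $A$. Uniform weight conditions with exponent $d_f$: there are constants $c_{\rm e},c_{\rm v}<\infty$, $p_0>0$ such that for all $N$: (i) $c_{\rm e}^{-1}\le\mu^{(N)}_{xy}\le c_{\rm e}$ for all $xy\in E(G^{(N)})$; (ii) $\mu^{(N)}_{xy}/\mu^{(N)}_x\ge p_0$ for all $xy\in E(G^{(N)})$; (iii) $c_{\rm v}^{-1}r^{d_f}\le V^{(N)}(x,r)\le c_{\rm v}r^{d_f}$ for all $x\in V(G^{(N)})$ and $1\le r\le\mathrm{diam}\{G^{(N)}\}$, and $\mathrm{diam}\{G^{(N)}\}\to\infty$. Conditions (i),(ii) imply uniformly bounded degrees and the existence of the constant $\tilde c$. $\mathrm{UPHI}(d_w)$: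 there are $C_{\rm PHI}<\infty$ and $c_{\rm PHI}\in(0,1]$, independent of $N$, such that for all $N\ge1$, $x_0\in V(G^{(N)})$, $1\le R\le c_{\rm PHI}\,\mathrm{diam}\{G^{(N)}\}$, and $T\ge2R$ with $T\asymp R^{d_w}$, every nonnegative $u:\{0,1,2,\dots\}\times V(G^{(N)})\to[0,\infty)$ satisfying $u(t+1,x)-u(t,x)=(P^{(N)}-I)u(t,x)$ for all integers $t\in[0,4T]$ and all $x\in B^{(N)}(x_0,2R)$ satisfies $$\max_{z\in B^{(N)}(x_0,R),\,s\in[T,2T]}u(s,z)\le C_{\rm PHI}\min_{z\in B^{(N)}(x_0,R),\,s\in[3T,4T]}\{u(s,z)+u(s+1,z)\}$$ ($s$ integer). Here $T\asymp R^{d_w}$ means $c^{-1}R^{d_w}\le T\le cR^{d_w}$ for a constant $c<\infty$; the inequality is assumed for every such $c$, with $C_{\rm PHI}$ allowed to depend on $c$. Lamplighter chain: $\mathbb{Z}_2\wr G$ has vertex set $\mathbb{Z}_2^{V(G)}\times V(G)$. The lamplighter chain $Y_t=(f_t,\tilde X_t)$ has transition probability $P^*((f,x),(g,y))$ equal to $\frac12\tilde P(x,x)=\frac14$ if $x=y$ and $f(v)=g(v)$ for all $v\ne x$; $\frac14\tilde P(x,y)=\frac18P(x,y)$ if $x\neq y$ and $f(v)=g(v)$ for all $v\ne x,y$; and $0$ otherwise. $P^*_t(\mathbf{x},\cdot\,;G)$ is the law of $Y_t$ started at $\mathbf{x}$; the invariant law is $\pi^*((f,y);G)=2^{-\sharp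 V(G)}\mu_y/\mu(V(G))$. $\|\mu-\nu\|_{\rm TV}=\frac12\sum_x|\mu(x)-\nu(x)|$. *)

theory Defs
  imports Complex_Main "HOL-Library.FuncSet" "HOL-Library.Z2"
begin

section \<open>Weighted graphs\<close>

text \<open>An undirected edge \<open>xy\<close> is represented by the two ordered pairs
  \<open>(x, y)\<close> and \<open>(y, x)\<close>.\<close>

record 'a wgraph =
  verts :: "'a set"
  edges :: "('a \<times> 'a) set"
  weight :: "'a \<Rightarrow> 'a \<Rightarrow> real"

text \<open>Loops are excluded: otherwise the lazy walk below, which puts mass exactly \<open>1/2\<close>
  on the diagonal, would not be stochastic. The weight function is only constrained on vertices.\<close>

definition finite_weighted_graph :: "'a wgraph \<Rightarrow> bool" where
  "finite_weighted_graph G \<longleftrightarrow>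
     finite (verts G) \<and> verts G \<noteq> {} \<and>
     edges G \<subseteq> verts G \<times> verts G \<and> sym (edges G) \<and> irrefl (edges G) \<and>
     (\<forall>x\<in>verts G. \<forall>y\<in>verts G. (x, y) \<in> (edges G)\<^sup>*) \<and>
     (\<forall>x\<in>verts G. \<forall>y\<in>verts G.
        weight G x y \<ge> 0 \<and> weight G x y = weight G y x \<and>
        (weight G x y > 0 \<longleftrightarrow> (x, y) \<in> edges G))"

definition gdist :: "'a wgraph \<Rightarrow> 'a \<Rightarrow> 'a \<Rightarrow> nat" where
  "gdist G x y = (LEAST n. (x, y) \<in> edges G ^^ n)"

definition gball :: "'a wgraph \<Rightarrow> 'a \<Rightarrow> real \<Rightarrow> 'a set" where
  "gball G x r = {y \<in> verts G. real (gdist G x y) \<le> r}"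

definition gdiam :: "'a wgraph \<Rightarrow> nat" where
  "gdiam G = (MAX (x, y) \<in> verts G \<times> verts G. gdist G x y)"

definition vweight :: "'a wgraph \<Rightarrow> 'a \<Rightarrow> real" where
  "vweight G x = (\<Sum>y | (x, y) \<in> edges G. weight G x y)"

definition set_weight :: "'a wgraph \<Rightarrow> 'a set \<Rightarrow> real" where
  "set_weight G A = (\<Sum>x\<in>A. vweight G x)"

definition vol :: "'a wgraph \<Rightarrow> 'a \<Rightarrow> real \<Rightarrow> real" where
  "vol G x r = set_weight G (gball G x r)"

definition walk :: "'a wgraph \<Rightarrow> 'a \<Rightarrow> 'a \<Rightarrow> real" where
  "walk G x y = weight G x y / vweight G x"

definition lazy_walk :: "'a wgraph \<Rightarrow> 'a \<Rightarrow> 'a \<Rightarrow> real" where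
  "lazy_walk G x y = (if x = y then 1 / 2 else walk G x y / 2)"


section \<open>Uniform conditions on a sequence of weighted graphs indexed by \<open>N \<ge> 1\<close>\<close>

definition uniform_weight_conditions ::
    "(nat \<Rightarrow> 'a wgraph) \<Rightarrow> real \<Rightarrow> real \<Rightarrow> bool" where
  "uniform_weight_conditions G d_f c_v \<longleftrightarrow>
     c_v > 0 \<and>
     (\<exists>c_e > 0. \<forall>N\<ge>1. \<forall>(x, y)\<in>edges (G N).
        inverse c_e \<le> weight (G N) x y \<and> weight (G N) x y \<le> c_e) \<and>
     (\<exists>p0 > 0. \<forall>N\<ge>1. \<forall>(x, y)\<in>edges (G N).
        weight (G N) x y / vweight (G N) x \<ge> p0) \<and>
     (\<forall>N\<ge>1. \<forall>x\<in>verts (G N). \<forall>r::real. 1 \<le> r \<and> r \<le> real (gdiam (G N)) \<longrightarrow>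
        inverse c_v * r powr d_f \<le> vol (G N) x r \<and> vol (G N) x r \<le> c_v * r powr d_f) \<and>
     filterlim (\<lambda>N. gdiam (G N)) at_top sequentially"

text \<open>\<open>u\<close> satisfies \<open>u(t+1,x) - u(t,x) = (P - I) u(t,x)\<close> for all integers
  \<open>t \<in> [0, T]\<close> and all \<open>x \<in> B\<close>.\<close>

definition caloric_on :: "'a wgraph \<Rightarrow> real \<Rightarrow> 'a set \<Rightarrow> (nat \<Rightarrow> 'a \<Rightarrow> real) \<Rightarrow> bool" where
  "caloric_on G T B u \<longleftrightarrow>
     (\<forall>t. real t \<le> T \<longrightarrow> (\<forall>x\<in>B.
        u (t + 1) x - u t x = (\<Sum>y\<in>verts G. walk G x y * u t y) - u t x))"

text \<open>Here \<open>c\<close> is the constant implicit in \<open>T \<asymp> R\<^bsup>d_w\<^esup>\<close>: the Harnack constant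
  \<open>C\<close> may depend on it, the range constant \<open>c_PHI\<close> may not.
  The radius \<open>R\<close> and the time \<open>T\<close> are real numbers.\<close>

definition UPHI :: "(nat \<Rightarrow> 'a wgraph) \<Rightarrow> real \<Rightarrow> bool" where
  "UPHI G d_w \<longleftrightarrow>
     (\<exists>c_PHI. 0 < c_PHI \<and> c_PHI \<le> 1 \<and>
       (\<forall>c > 0. \<exists>C > 0.
         \<forall>N\<ge>1. \<forall>x0\<in>verts (G N). \<forall>R T :: real.
           1 \<le> R \<and> R \<le> c_PHI * real (gdiam (G N)) \<and> 2 * R \<le> T \<and>
           inverse c * R powr d_w \<le> T \<and> T \<le> c * R powr d_w \<longrightarrow>
           (\<forall>u :: nat \<Rightarrow> 'a \<Rightarrow> real.
             (\<forall>t. \<forall>x\<in>verts (G N). u t x \<ge> 0) \<and>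
             caloric_on (G N) (4 * T) (gball (G N) x0 (2 * R)) u \<longrightarrow>
             (MAX (z, s) \<in> gball (G N) x0 R \<times> {s. T \<le> real s \<and> real s \<le> 2 * T}. u s z)
             \<le> C * (MIN (z, s) \<in> gball (G N) x0 R \<times> {s. 3 * T \<le> real s \<and> real s \<le> 4 * T}.
                      u s z + u (s + 1) z))))"


section \<open>The lamplighter chain\<close>

text \<open>Lamp configurations are functions on the vertex set, made canonical outside of it
  by \<^const>\<open>PiE\<close>.\<close>

definition lamp_states :: "'a wgraph \<Rightarrow> (('a \<Rightarrow> bit) \<times> 'a) set" where
  "lamp_states G = (verts G \<rightarrow>\<^sub>E (UNIV :: bit set)) \<times> verts G"

definition lamp_step ::
    "'a wgraph \<Rightarrow> ('a \<Rightarrow> bit) \<times> 'a \<Rightarrow> ('a \<Rightarrow> bit) \<times> 'a \<Rightarrow> real" where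
  "lamp_step G = (\<lambda>(f, x) (g, y).
     if x = y \<and> (\<forall>v \<in> verts G - {x}. f v = g v) then lazy_walk G x x / 2
     else if x \<noteq> y \<and> (\<forall>v \<in> verts G - {x, y}. f v = g v) then lazy_walk G x y / 4
     else 0)"

fun lamp_law ::
    "'a wgraph \<Rightarrow> nat \<Rightarrow> ('a \<Rightarrow> bit) \<times> 'a \<Rightarrow> ('a \<Rightarrow> bit) \<times> 'a \<Rightarrow> real" where
  "lamp_law G 0 a b = (if a = b then 1 else 0)"
| "lamp_law G (Suc t) a b = (\<Sum>c\<in>lamp_states G. lamp_law G t a c * lamp_step G c b)"

definition lamp_stationary :: "'a wgraph \<Rightarrow> ('a \<Rightarrow> bit) \<times> 'a \<Rightarrow> real" where
  "lamp_stationary G = (\<lambda>(f, y).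
     inverse (2 ^ card (verts G)) * vweight G y / set_weight G (verts G))"

definition tv_dist :: "'s set \<Rightarrow> ('s \<Rightarrow> real) \<Rightarrow> ('s \<Rightarrow> real) \<Rightarrow> real" where
  "tv_dist S p q = (\<Sum>s\<in>S. \<bar>p s - q s\<bar>) / 2"

end

theory Submission
  imports Defs "HOL-Real_Asymp.Real_Asymp"
begin

text \<open>
  With a probability bounded away from \<open>0\<close>, the walk started at \<open>x\<close> stays for a time of order
  \<open>T = diam powr d_w\<close> in a ball \<open>B\<close> about \<open>x\<close> whose radius is a small fraction of the diameter,
  and the probability that it stays there up to time \<open>t\<close> decays no faster than
  \<open>exp (- c t / T)\<close>. If all lamps are off initially, then as long as it stays there no lamp
  outside of \<open>B\<close> is switched on, whereas in
  equilibrium all these lamps are off with a probability that is exponentially small in the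
  diameter. The event that the lamps outside of \<open>B\<close> are off and the lamplighter is in \<open>B\<close>
  therefore separates the two laws.

  The survival estimate comes from the Harnack inequality
  (lemma \<open>survival_ge_of_Harnack\<close>). The survival probability is caloric in \<open>B\<close>, and it
  remains caloric there when it is prolonged by the constant \<open>1\<close> to negative times, because
  the heat equation is not imposed outside of \<open>B\<close>. So the inequality says that it drops at
  most by a constant factor over a period of length about \<open>2 T\<close>, from time \<open>0\<close> on, and this can be
  iterated. Lemma \<open>survival_le_lamp_law\<close> carries the bound over to the lamplighter chain, and
  lemma \<open>sum_lamp_stationary_confined_le\<close> bounds the equilibrium probability by
  \<open>2\<close> to the power minus the number of vertices outside of \<open>B\<close>. Let \<open>B\<close> be centred
  at an end of a geodesic whose length is the diameter. The other half of this geodesic lies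
  outside of \<open>B\<close> (lemma \<open>card_outside_half_ball\<close>), so for large diameters the equilibrium
  probability is below any given positive multiple of a negative power of the diameter.
\<close>

section \<open>Finite weighted graphs\<close>

lemma gdist_relpow:
  assumes "finite_weighted_graph G" "x \<in> verts G" "y \<in> verts G"
  shows "(x, y) \<in> edges G ^^ gdist G x y"
proof -
  have "(x, y) \<in> (edges G)\<^sup>*"
    using assms by (auto simp: finite_weighted_graph_def)
  then obtain n where "(x, y) \<in> edges G ^^ n"
    using rtrancl_imp_relpow by blast
  then show ?thesis
    unfolding gdist_def by (rule LeastI)
qed

lemma gdist_le: "(x, y) \<in> edges G ^^ n \<Longrightarrow> gdist G x y \<le> n"
  unfolding gdist_def by (rule Least_le)

lemma gdist_refl [simp]: "gdist G x x = 0"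
  using gdist_le[of x x 0 G] by simp

lemma center_in_gball: "x \<in> verts G \<Longrightarrow> 0 \<le> r \<Longrightarrow> x \<in> gball G x r"
  by (simp add: gball_def)

lemma gdiam_attained:
  assumes "finite_weighted_graph G"
  obtains x y where "x \<in> verts G" "y \<in> verts G" "gdist G x y = gdiam G"
proof -
  let ?f = "\<lambda>(x, y). gdist G x y"
  have "finite (?f ` (verts G \<times> verts G))" "?f ` (verts G \<times> verts G) \<noteq> {}"
    using assms by (auto simp: finite_weighted_graph_def)
  from Max_in[OF this] have "gdiam G \<in> ?f ` (verts G \<times> verts G)"
    by (simp add: gdiam_def)
  then show ?thesis using that by auto
qed

lemma geodesic_vertex:
  assumes G: "finite_weighted_graph G" and x: "x \<in> verts G" and y: "y \<in> verts G"
    and k: "k \<le> gdist G x y"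
  obtains z where "z \<in> verts G" "gdist G x z = k"
proof -
  have "(x, y) \<in> edges G ^^ (k + (gdist G x y - k))"
    using gdist_relpow[OF G x y] k by simp
  then obtain z where z: "(x, z) \<in> edges G ^^ k" "(z, y) \<in> edges G ^^ (gdist G x y - k)"
    by (auto simp: relpow_add)
  have E: "edges G \<subseteq> verts G \<times> verts G"
    using G by (auto simp: finite_weighted_graph_def)
  have zV: "z \<in> verts G"
  proof (cases k)
    case 0
    then show ?thesis using z x by simp
  next
    case (Suc j)
    then show ?thesis using z E by auto
  qed
  have "(x, y) \<in> edges G ^^ (gdist G x z + (gdist G x y - k))"
    unfolding relpow_add using gdist_relpow[OF G x zV] z by blast
  then have "gdist G x y \<le> gdist G x z + (gdist G x y - k)"
    by (rule gdist_le)
  with k gdist_le[OF z(1)] have "gdist G x z = k" by simp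
  with zV that show ?thesis by blast
qed

text \<open>The second half of a geodesic from \<open>x\<close> to \<open>y\<close> lies outside of the ball.\<close>

lemma card_outside_half_ball:
  assumes G: "finite_weighted_graph G" and x: "x \<in> verts G" and y: "y \<in> verts G"
    and xy: "gdist G x y = gdiam G" and r: "r \<le> real (gdiam G) / 2"
  shows "real (gdiam G) / 2 \<le> real (card (verts G - gball G x r))"
proof -
  let ?D = "gdiam G" and ?A = "verts G - gball G x r"
  have fin: "finite ?A" using G by (simp add: finite_weighted_graph_def)
  have "{?D div 2<..?D} \<subseteq> gdist G x ` ?A"
  proof
    fix k assume k: "k \<in> {?D div 2<..?D}"
    then obtain z where "z \<in> verts G" "gdist G x z = k"
      using geodesic_vertex[OF G x y, of k] xy by auto
    moreover have "r < real k" using k r by auto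
    ultimately show "k \<in> gdist G x ` ?A" by (auto simp: gball_def)
  qed
  then have "card {?D div 2<..?D} \<le> card (gdist G x ` ?A)"
    using fin by (intro card_mono) auto
  also have "\<dots> \<le> card ?A" using fin by (rule card_image_le)
  finally show ?thesis by simp
qed

lemma vweight_nonneg:
  assumes "finite_weighted_graph G"
  shows "0 \<le> vweight G x"
  unfolding vweight_def using assms
  by (intro sum_nonneg) (auto simp: finite_weighted_graph_def)

lemma walk_nonneg:
  assumes "finite_weighted_graph G" "x \<in> verts G" "y \<in> verts G"
  shows "0 \<le> walk G x y"
  using assms vweight_nonneg[of G x] by (auto simp: finite_weighted_graph_def walk_def)

lemma lazy_walk_nonneg:
  assumes "finite_weighted_graph G" "x \<in> verts G" "y \<in> verts G"
  shows "0 \<le> lazy_walk G x y"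
  using walk_nonneg[OF assms] by (simp add: lazy_walk_def)

lemma walk_refl:
  assumes "finite_weighted_graph G" "x \<in> verts G"
  shows "walk G x x = 0"
proof -
  have "(x, x) \<notin> edges G" using assms by (auto simp: finite_weighted_graph_def irrefl_def)
  then have "weight G x x = 0"
    using assms by (metis finite_weighted_graph_def order_le_less)
  then show ?thesis by (simp add: walk_def)
qed

lemma sum_walk:
  assumes G: "finite_weighted_graph G" and x: "x \<in> verts G" and pos: "vweight G x > 0"
  shows "(\<Sum>y\<in>verts G. walk G x y) = 1"
proof -
  have "(\<Sum>y\<in>verts G. weight G x y) = vweight G x"
    unfolding vweight_def
  proof (rule sum.mono_neutral_right)
    show "finite (verts G)" using G by (simp add: finite_weighted_graph_def)
    show "{y. (x, y) \<in> edges G} \<subseteq> verts G" using G by (auto simp: finite_weighted_graph_def)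
    show "\<forall>y\<in>verts G - {y. (x, y) \<in> edges G}. weight G x y = 0"
      using G x unfolding finite_weighted_graph_def
      by (metis DiffD1 DiffD2 mem_Collect_eq order_le_less)
  qed
  with pos show ?thesis by (simp add: walk_def flip: sum_divide_distrib)
qed


section \<open>Survival of the walk in a ball\<close>

text \<open>The probability that the walk started at \<open>x\<close> is in \<open>B\<close> at each of the times
  \<open>0, \<dots>, t - 1\<close>. At \<open>t = 0\<close> this is \<open>1\<close> even outside of \<open>B\<close>, so that the survival
  probability can be prolonged by the constant \<open>1\<close> to earlier times and still satisfies the
  heat equation in \<open>B\<close>.\<close>

primrec survival :: "'a wgraph \<Rightarrow> 'a set \<Rightarrow> nat \<Rightarrow> 'a \<Rightarrow> real" where
  "survival G B 0 x = 1"
| "survival G B (Suc t) x =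
     (if x \<in> B then \<Sum>y\<in>verts G. walk G x y * survival G B t y else 0)"

lemma survival_nonneg:
  assumes "finite_weighted_graph G" "B \<subseteq> verts G"
  shows "0 \<le> survival G B t x"
  using assms by (induction t arbitrary: x) (auto intro!: sum_nonneg mult_nonneg_nonneg walk_nonneg)

lemma survival_Suc_le:
  assumes G: "finite_weighted_graph G" and B: "B \<subseteq> verts G"
    and pos: "\<And>x. x \<in> verts G \<Longrightarrow> vweight G x > 0"
  shows "survival G B (Suc t) x \<le> survival G B t x"
proof (induction t arbitrary: x)
  case 0
  show ?case using sum_walk[OF G _ pos, of x] B by auto
next
  case (Suc t)
  show ?case
  proof (cases "x \<in> B")
    case True
    with B have "x \<in> verts G" by auto
    then have "(\<Sum>y\<in>verts G. walk G x y * survival G B (Suc t) y)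
        \<le> (\<Sum>y\<in>verts G. walk G x y * survival G B t y)"
      by (intro sum_mono mult_left_mono Suc.IH walk_nonneg G)
    with True show ?thesis by simp
  qed simp
qed

lemma survival_antimono:
  assumes "finite_weighted_graph G" "B \<subseteq> verts G"
    and "\<And>x. x \<in> verts G \<Longrightarrow> vweight G x > 0" and "s \<le> t"
  shows "survival G B t x \<le> survival G B s x"
  using lift_Suc_antimono_le[of "\<lambda>t. survival G B t x" s t] survival_Suc_le[OF assms(1-3)] assms(4)
  by blast

text \<open>Truncated subtraction prolongs the survival probability by \<open>1\<close>: the time argument is
  \<open>0\<close> as long as \<open>t + j \<le> a\<close>.\<close>

lemma caloric_survival_shift:
  assumes G: "finite_weighted_graph G" and B: "B \<subseteq> verts G"
    and pos: "\<And>x. x \<in> verts G \<Longrightarrow> vweight G x > 0"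
  shows "caloric_on G T B (\<lambda>t. survival G B (t + j - a))"
  unfolding caloric_on_def
proof (intro allI impI ballI)
  fix t x assume x: "x \<in> B"
  have "survival G B (t + 1 + j - a) x = (\<Sum>y\<in>verts G. walk G x y * survival G B (t + j - a) y)"
  proof (cases "a \<le> t + j")
    case True
    then have "t + 1 + j - a = Suc (t + j - a)" by simp
    with x show ?thesis by simp
  next
    case False
    then have "t + 1 + j - a = 0" "t + j - a = 0" by simp_all
    then show ?thesis using sum_walk[OF G _ pos] x B by auto
  qed
  then show "survival G B (t + 1 + j - a) x - survival G B (t + j - a) x =
      (\<Sum>y\<in>verts G. walk G x y * survival G B (t + j - a) y) - survival G B (t + j - a) x"
    by simp
qed

lemma Max_le_Min_pointwise:
  fixes f g :: "'b \<Rightarrow> real"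
  assumes "(MAX p\<in>A. f p) \<le> C * (MIN q\<in>B. g q)" "finite A" "finite B" "p \<in> A" "q \<in> B" "C \<ge> 0"
  shows "f p \<le> C * g q"
proof -
  have "f p \<le> (MAX p\<in>A. f p)" using assms by (intro Max_ge) auto
  also note assms(1)
  also have "C * (MIN q\<in>B. g q) \<le> C * g q"
    using assms by (intro mult_left_mono Min_le) auto
  finally show ?thesis .
qed

text \<open>Let \<open>a\<close> and \<open>b\<close> be the last integers in \<open>[T, 2T]\<close> and \<open>[3T, 4T]\<close>. The prolonged
  survival probability can be shifted in time such that its values at \<open>a\<close> and \<open>b\<close> are the
  survival probabilities for the times \<open>j\<close> and \<open>j + (b - a)\<close>, where \<open>j\<close> is arbitrary. By the
  Harnack inequality and monotonicity in time, the former is at most \<open>2 C\<close> times the latter.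
  Starting from the value \<open>1\<close> at \<open>j = 0\<close>, iteration gives the exponential lower bound.\<close>

lemma survival_ge_of_Harnack:
  fixes G :: "'a wgraph" and x0 :: 'a and R T C L :: real
  defines "B \<equiv> gball G x0 (2 * R)"
  assumes G: "finite_weighted_graph G" and x0: "x0 \<in> verts G"
    and pos: "\<And>x. x \<in> verts G \<Longrightarrow> vweight G x > 0"
    and R: "R \<ge> 0" and T: "T \<ge> 1" and C: "C \<ge> 0"
    and Harnack: "\<And>u :: nat \<Rightarrow> 'a \<Rightarrow> real.
      (\<forall>t. \<forall>x\<in>verts G. u t x \<ge> 0) \<and> caloric_on G (4 * T) B u \<Longrightarrow>
      (MAX (z, s) \<in> gball G x0 R \<times> {s. T \<le> real s \<and> real s \<le> 2 * T}. u s z)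
      \<le> C * (MIN (z, s) \<in> gball G x0 R \<times> {s. 3 * T \<le> real s \<and> real s \<le> 4 * T}.
                u s z + u (s + 1) z)"
    and L: "L \<ge> 1" "L \<ge> 2 * C"
  shows "survival G B n x0 \<ge> inverse L * exp (- ln L * real n / T)"
proof -
  have BV: "B \<subseteq> verts G" by (auto simp: B_def gball_def)
  define a b where "a = nat \<lfloor>2 * T\<rfloor>" and "b = nat \<lfloor>4 * T\<rfloor>"
  have a: "T \<le> real a" "real a \<le> 2 * T" and b: "3 * T \<le> real b" "real b \<le> 4 * T"
    using T unfolding a_def b_def by linarith+
  have h: "T \<le> real (b - a)" using a b by linarith
  have fin: "finite {s::nat. p \<le> real s \<and> real s \<le> q}" for p q
    by (rule finite_subset[of _ "{..nat \<lceil>q\<rceil>}"]) (auto, linarith)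
  have finB: "finite (gball G x0 R)"
    using G by (auto simp: gball_def finite_weighted_graph_def)
  have x0B: "x0 \<in> gball G x0 R" using x0 R by (rule center_in_gball)
  have step: "survival G B j x0 \<le> L * survival G B (j + (b - a)) x0" for j
  proof -
    let ?u = "\<lambda>t. survival G B (t + j - a)"
    have "(MAX (z, s) \<in> gball G x0 R \<times> {s. T \<le> real s \<and> real s \<le> 2 * T}. ?u s z)
      \<le> C * (MIN (z, s) \<in> gball G x0 R \<times> {s. 3 * T \<le> real s \<and> real s \<le> 4 * T}.
                ?u s z + ?u (s + 1) z)"
      using caloric_survival_shift[OF G BV pos] survival_nonneg[OF G BV] by (intro Harnack) blast
    from Max_le_Min_pointwise[OF this, of "(x0, a)" "(x0, b)"]
    have "?u a x0 \<le> C * (?u b x0 + ?u (b + 1) x0)"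
      using a b C fin finB x0B by simp
    also have "\<dots> \<le> C * (2 * ?u b x0)"
      using survival_antimono[OF G BV pos, of "b + j - a" "b + 1 + j - a" x0] C
      by (intro mult_left_mono) auto
    also have "\<dots> = 2 * C * survival G B (j + (b - a)) x0"
    proof -
      have "b + j - a = j + (b - a)" using a b T by linarith
      then show ?thesis by simp
    qed
    also have "\<dots> \<le> L * survival G B (j + (b - a)) x0"
      using L survival_nonneg[OF G BV] by (intro mult_right_mono)
    finally show ?thesis by simp
  qed
  have iter: "1 \<le> L ^ k * survival G B (k * (b - a)) x0" for k
  proof (induction k)
    case (Suc k)
    note Suc
    also have "L ^ k * survival G B (k * (b - a)) x0
        \<le> L ^ k * (L * survival G B (k * (b - a) + (b - a)) x0)"
      using step L by (intro mult_left_mono) auto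
    finally show ?case by (simp add: ac_simps)
  qed simp
  \<comment> \<open>The number of periods \<open>b - a \<ge> T\<close> that cover the time \<open>n\<close>.\<close>
  define k where "k = nat \<lceil>real n / T\<rceil>"
  have k: "real n / T \<le> real k" "real k \<le> real n / T + 1"
    using T by (auto simp: k_def) 
  have "real n \<le> real k * T" using k(1) T by (simp add: divide_simps)
  also have "\<dots> \<le> real k * real (b - a)" using h by (intro mult_left_mono) auto
  finally have nk: "n \<le> k * (b - a)" by (metis of_nat_le_iff of_nat_mult)
  have "L ^ k = L powr real k" using L by (simp add: powr_realpow)
  also have "\<dots> \<le> L powr (real n / T + 1)" using k L by (intro powr_mono) auto
  also have "\<dots> = L * exp (ln L * real n / T)"
    using L by (simp add: powr_def exp_add distrib_left mult.commute)
  finally have Lk: "L ^ k \<le> L * exp (ln L * real n / T)" .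
  have "inverse L * exp (- ln L * real n / T) = inverse (L * exp (ln L * real n / T))"
    by (simp add: exp_minus)
  also have "\<dots> \<le> inverse (L ^ k)" using Lk L by (intro le_imp_inverse_le) auto
  also have "\<dots> \<le> survival G B (k * (b - a)) x0"
    using iter[of k] L by (simp add: field_simps)
  also have "\<dots> \<le> survival G B n x0" by (rule survival_antimono[OF G BV pos nk])
  finally show ?thesis .
qed

text \<open>The survival probability is subcaloric for the lazy walk, since a lazy step averages its
  values before and after a step of the walk, and the former is the larger one. The time argument
  on the right is positive, so that the sum over \<open>B\<close> misses nothing.\<close>

lemma survival_le_lazy_walk:
  assumes G: "finite_weighted_graph G" and B: "B \<subseteq> verts G"
    and pos: "\<And>x. x \<in> verts G \<Longrightarrow> vweight G x > 0" and x: "x \<in> B"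
  shows "survival G B (Suc (Suc t)) x \<le> (\<Sum>y\<in>B. lazy_walk G x y * survival G B (Suc t) y)"
proof -
  let ?v = "survival G B"
  have finV: "finite (verts G)" using G by (simp add: finite_weighted_graph_def)
  have finB: "finite B" using finV B finite_subset by blast
  have lazy: "lazy_walk G x y = walk G x y / 2 + (if y = x then 1 / 2 else 0)" for y
    using walk_refl[OF G] x B by (auto simp: lazy_walk_def)
  have "(\<Sum>y\<in>B. walk G x y * ?v (Suc t) y) = (\<Sum>y\<in>verts G. walk G x y * ?v (Suc t) y)"
    by (rule sum.mono_neutral_left[OF finV B]) auto
  then have W: "(\<Sum>y\<in>B. walk G x y * ?v (Suc t) y) = ?v (Suc (Suc t)) x"
    using x by simp
  have "(\<Sum>y\<in>B. lazy_walk G x y * ?v (Suc t) y)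
      = (\<Sum>y\<in>B. walk G x y * ?v (Suc t) y / 2 + (if y = x then ?v (Suc t) y / 2 else 0))"
    by (intro sum.cong) (auto simp only: lazy distrib_right if_distrib split: if_splits)
  also have "\<dots> = ?v (Suc (Suc t)) x / 2 + ?v (Suc t) x / 2"
    using x finB by (simp only: sum.distrib W flip: sum_divide_distrib) simp
  finally show ?thesis
    using survival_Suc_le[OF G B pos, of "Suc t" x] by linarith
qed


section \<open>The lamplighter confined to a set\<close>

definition confined_states :: "'a wgraph \<Rightarrow> 'a set \<Rightarrow> (('a \<Rightarrow> bit) \<times> 'a) set" where
  "confined_states G B = (\<Pi>\<^sub>E v\<in>verts G. if v \<in> B then UNIV else {0}) \<times> B"

lemma UNIV_bit: "(UNIV :: bit set) = {0, 1}"
  by auto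

lemma card_UNIV_bit: "card (UNIV :: bit set) = 2"
  by (simp add: UNIV_bit)

lemma finite_lamp_states: "finite_weighted_graph G \<Longrightarrow> finite (lamp_states G)"
  by (auto simp: lamp_states_def finite_weighted_graph_def UNIV_bit
      intro!: finite_PiE finite_cartesian_product)

lemma confined_states_subset: "B \<subseteq> verts G \<Longrightarrow> confined_states G B \<subseteq> lamp_states G"
  by (auto simp: confined_states_def lamp_states_def PiE_iff)

lemma lamp_step_nonneg:
  assumes "finite_weighted_graph G" "a \<in> lamp_states G" "b \<in> lamp_states G"
  shows "0 \<le> lamp_step G a b"
  using assms by (auto simp: lamp_step_def lamp_states_def lazy_walk_nonneg split: prod.splits)

lemma lamp_law_nonneg:
  assumes "finite_weighted_graph G" "b \<in> lamp_states G"
  shows "0 \<le> lamp_law G t a b"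
  using assms
  by (induction t arbitrary: b) (auto intro!: sum_nonneg mult_nonneg_nonneg lamp_step_nonneg)

text \<open>A step from \<open>x\<close> to \<open>y\<close> leads to each of the two (if \<open>x = y\<close>) or four configurations
  that differ from the present one at most in \<open>x\<close> and \<open>y\<close>. If both are in \<open>B\<close>, then the
  lamps off \<open>B\<close> are not touched, so all of these configurations are confined again.\<close>

lemma lazy_walk_le_sum_lamp_step:
  assumes G: "finite_weighted_graph G" and B: "B \<subseteq> verts G"
    and fx: "(f, x) \<in> confined_states G B" and y: "y \<in> B"
  shows "lazy_walk G x y
    \<le> (\<Sum>g\<in>(\<Pi>\<^sub>E v\<in>verts G. if v \<in> B then UNIV else {0}). lamp_step G (f, x) (g, y))"
    (is "_ \<le> sum ?p ?F")
proof -
  have x: "x \<in> B" and f: "f \<in> ?F" using fx by (auto simp: confined_states_def)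
  have upd: "g(z := i) \<in> ?F" if "g \<in> ?F" "z \<in> B" for g z i
    using that B by (fastforce simp: PiE_iff extensional_def)
  have finF: "finite ?F"
    using G by (auto simp: finite_weighted_graph_def UNIV_bit intro!: finite_PiE split: if_splits)
  have p0: "0 \<le> ?p g" if "g \<in> ?F" for g
    using that x y B fx confined_states_subset[OF B]
    by (intro lamp_step_nonneg G) (auto simp: confined_states_def)
  let ?h = "\<lambda>(i, j). f(x := i, y := j)"
  let ?I = "if x = y then {0} \<times> UNIV else (UNIV :: (bit \<times> bit) set)"
  have inj: "inj_on ?h ?I"
    by (rule inj_onI) (auto simp: fun_eq_iff split: if_splits; metis)
  have card: "card ?I = (if x = y then 2 else 4)"
    using card_cartesian_product[of "UNIV :: bit set" "UNIV :: bit set"]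
    by (simp add: card_cartesian_product card_UNIV_bit)
  have "lazy_walk G x y = (\<Sum>q\<in>?I. if x = y then lazy_walk G x y / 2 else lazy_walk G x y / 4)"
    by (simp add: card)
  also have "\<dots> = (\<Sum>q\<in>?I. ?p (?h q))"
    by (intro sum.cong) (auto simp: lamp_step_def split: if_splits)
  also have "\<dots> = sum ?p (?h ` ?I)" using inj by (simp add: sum.reindex)
  also have "\<dots> \<le> sum ?p ?F"
  proof (rule sum_mono2[OF finF])
    show "?h ` ?I \<subseteq> ?F"
      using upd[OF upd[OF f x] y] by (intro image_subsetI) (simp only: case_prod_beta)
  qed (use p0 in blast)
  finally show ?thesis .
qed

text \<open>The expectation of the survival probability for a remaining time \<open>s\<close>, taken on the
  confined states, is nondecreasing if at each step of the chain \<open>s\<close> is lowered by one.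
  The bound on the mass of the confined states is the case \<open>s = 0\<close>, as the survival probability
  for one time is the indicator of \<open>B\<close>.\<close>

lemma survival_le_lamp_law:
  assumes G: "finite_weighted_graph G" and B: "B \<subseteq> verts G"
    and pos: "\<And>x. x \<in> verts G \<Longrightarrow> vweight G x > 0"
    and a: "a \<in> confined_states G B"
  shows "survival G B (Suc (s + t)) (snd a)
    \<le> (\<Sum>b\<in>confined_states G B. lamp_law G t a b * survival G B (Suc s) (snd b))"
proof (induction t arbitrary: s)
  case 0
  have "finite (confined_states G B)"
    using finite_lamp_states[OF G] confined_states_subset[OF B] finite_subset by blast
  then show ?case using a by (simp add: if_distrib if_distribR sum.delta del: survival.simps cong: if_cong)
next
  case (Suc t)
  let ?A = "confined_states G B" and ?v = "survival G B"
  let ?F = "\<Pi>\<^sub>E v\<in>verts G. if v \<in> B then (UNIV :: bit set) else {0}"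
  note sub = confined_states_subset[OF B]
  have step: "?v (Suc (Suc s)) (snd c) \<le> (\<Sum>b\<in>?A. lamp_step G c b * ?v (Suc s) (snd b))"
    if "c \<in> ?A" for c
  proof -
    obtain f x where c: "c = (f, x)" by (cases c)
    have x: "x \<in> B" using that c by (simp add: confined_states_def)
    have "?v (Suc (Suc s)) x \<le> (\<Sum>y\<in>B. lazy_walk G x y * ?v (Suc s) y)"
      by (rule survival_le_lazy_walk[OF G B pos x])
    also have "\<dots> \<le> (\<Sum>y\<in>B. (\<Sum>g\<in>?F. lamp_step G (f, x) (g, y)) * ?v (Suc s) y)"
      using that c by (intro sum_mono mult_right_mono lazy_walk_le_sum_lamp_step survival_nonneg G B) auto
    also have "\<dots> = (\<Sum>g\<in>?F. \<Sum>y\<in>B. lamp_step G (f, x) (g, y) * ?v (Suc s) y)"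
      by (subst sum.swap) (simp only: sum_distrib_right)
    also have "\<dots> = (\<Sum>b\<in>?A. lamp_step G c b * ?v (Suc s) (snd b))"
      unfolding confined_states_def sum.cartesian_product c by (simp add: case_prod_beta)
    finally show ?thesis using c by simp
  qed
  have "?v (Suc (s + Suc t)) (snd a) = ?v (Suc (Suc s + t)) (snd a)" by simp
  also have "\<dots> \<le> (\<Sum>c\<in>?A. lamp_law G t a c * ?v (Suc (Suc s)) (snd c))"
    by (rule Suc.IH)
  also have "\<dots> \<le> (\<Sum>c\<in>?A. lamp_law G t a c * (\<Sum>b\<in>?A. lamp_step G c b * ?v (Suc s) (snd b)))"
    using sub by (intro sum_mono mult_left_mono step lamp_law_nonneg G) auto
  also have "\<dots> \<le> (\<Sum>c\<in>lamp_states G.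
      lamp_law G t a c * (\<Sum>b\<in>?A. lamp_step G c b * ?v (Suc s) (snd b)))"
    using sub finite_lamp_states[OF G]
    by (intro sum_mono2 mult_nonneg_nonneg sum_nonneg lamp_law_nonneg lamp_step_nonneg
          survival_nonneg G B) auto
  also have "\<dots> = (\<Sum>b\<in>?A. \<Sum>c\<in>lamp_states G. lamp_law G t a c * (lamp_step G c b * ?v (Suc s) (snd b)))"
    by (subst sum.swap) (simp only: sum_distrib_left)
  also have "\<dots> = (\<Sum>b\<in>?A. lamp_law G (Suc t) a b * ?v (Suc s) (snd b))"
    by (simp only: lamp_law.simps sum_distrib_right mult.assoc)
  finally show ?case .
qed

lemma sum_lamp_stationary_confined_le:
  assumes G: "finite_weighted_graph G" and B: "B \<subseteq> verts G"
  shows "(\<Sum>b\<in>confined_states G B. lamp_stationary G b) \<le> inverse (2 ^ card (verts G - B))"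
proof -
  let ?F = "\<Pi>\<^sub>E v\<in>verts G. if v \<in> B then (UNIV :: bit set) else {0}"
  let ?n = "card (verts G)"
  have finV: "finite (verts G)" using G by (simp add: finite_weighted_graph_def)
  have finB: "finite B" using finV B finite_subset by blast
  have "card ?F = (\<Prod>v\<in>verts G. if v \<in> B then 2 else 1)"
    by (simp add: card_PiE[OF finV] if_distrib[of card] card_UNIV_bit cong: if_cong)
  also have "\<dots> = 2 ^ card B"
    using B by (simp add: prod.If_cases[OF finV] Int_absorb1)
  finally have cF: "card ?F = 2 ^ card B" .
  have le: "set_weight G B \<le> set_weight G (verts G)"
    unfolding set_weight_def by (intro sum_mono2 finV B vweight_nonneg G)
  have "(\<Sum>b\<in>confined_states G B. lamp_stationary G b)
      = (\<Sum>g\<in>?F. \<Sum>y\<in>B. inverse (2 ^ ?n) * vweight G y / set_weight G (verts G))"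
    unfolding confined_states_def sum.cartesian_product by (simp add: lamp_stationary_def)
  also have "\<dots> = 2 ^ card B * inverse (2 ^ ?n) * (set_weight G B / set_weight G (verts G))"
    by (simp add: cF set_weight_def sum_distrib_left sum_divide_distrib mult.assoc)
  also have "\<dots> \<le> 2 ^ card B * inverse (2 ^ ?n) * 1"
    using le sum_nonneg[of B "vweight G"] vweight_nonneg[OF G]
    by (intro mult_left_mono) (auto simp: divide_le_eq_1 set_weight_def)
  also have "?n = card B + card (verts G - B)"
    using card_mono[OF finV B] by (simp add: card_Diff_subset[OF finB B])
  finally show ?thesis by (simp add: power_add flip: mult.assoc)
qed

text \<open>The factor \<open>1 / 2\<close> is the price for admitting functions of unequal total mass.\<close>

lemma tv_dist_ge:
  assumes "finite S" "A \<subseteq> S"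
  shows "(sum p A - sum q A) / 2 \<le> tv_dist S p q"
proof -
  have "sum p A - sum q A = (\<Sum>s\<in>A. p s - q s)" by (simp add: sum_subtractf)
  also have "\<dots> \<le> (\<Sum>s\<in>A. \<bar>p s - q s\<bar>)" by (intro sum_mono) auto
  also have "\<dots> \<le> (\<Sum>s\<in>S. \<bar>p s - q s\<bar>)" using assms by (intro sum_mono2) auto
  finally show ?thesis by (simp add: tv_dist_def)
qed

lemma Max_tv_dist_ge_survival:
  assumes G: "finite_weighted_graph G" and B: "B \<subseteq> verts G"
    and pos: "\<And>x. x \<in> verts G \<Longrightarrow> vweight G x > 0" and x: "x \<in> B"
  shows "(survival G B (Suc t) x - inverse (2 ^ card (verts G - B))) / 2
    \<le> (MAX a \<in> lamp_states G.
         tv_dist (lamp_states G) (lamp_law G t a) (lamp_stationary G))"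
proof -
  define a :: "('a \<Rightarrow> bit) \<times> 'a" where "a = (\<lambda>v\<in>verts G. 0, x)"
  have a: "a \<in> confined_states G B" using x by (simp add: a_def confined_states_def PiE_iff)
  note sub = confined_states_subset[OF B]
  note fin = finite_lamp_states[OF G]
  have one: "survival G B (Suc 0) z \<le> 1" for z
    using survival_Suc_le[OF G B pos, of 0 z] by simp
  have "survival G B (Suc t) x
      \<le> (\<Sum>b\<in>confined_states G B. lamp_law G t a b * survival G B (Suc 0) (snd b))"
    using survival_le_lamp_law[OF G B pos a, of 0 t] by (simp add: a_def del: survival.simps)
  also have "\<dots> \<le> (\<Sum>b\<in>confined_states G B. lamp_law G t a b)"
    using sub one by (intro sum_mono mult_left_le lamp_law_nonneg G) auto
  finally have "(survival G B (Suc t) x - inverse (2 ^ card (verts G - B))) / 2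
      \<le> ((\<Sum>b\<in>confined_states G B. lamp_law G t a b)
        - (\<Sum>b\<in>confined_states G B. lamp_stationary G b)) / 2"
    using sum_lamp_stationary_confined_le[OF G B] by (intro divide_right_mono diff_mono) auto
  also have "\<dots> \<le> tv_dist (lamp_states G) (lamp_law G t a) (lamp_stationary G)"
    by (rule tv_dist_ge[OF fin sub])
  also have "\<dots> \<le> (MAX a \<in> lamp_states G.
         tv_dist (lamp_states G) (lamp_law G t a) (lamp_stationary G))"
    using a sub fin by (intro Max_ge) auto
  finally show ?thesis .
qed


section \<open>The lower bound\<close>

theorem proposition1p6:
  fixes G :: "nat \<Rightarrow> 'a wgraph" and d_f d_w c_v c_tilde :: real
  assumes "1 \<le> d_f" and "2 \<le> d_w"
    and "\<And>N. N \<ge> 1 \<Longrightarrow> finite_weighted_graph (G N)"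
    and "filterlim (\<lambda>N. card (verts (G N))) at_top sequentially"
    and "uniform_weight_conditions G d_f c_v"
    and "UPHI G d_w"
    and "c_tilde > 0"
    and "\<And>N x. N \<ge> 1 \<Longrightarrow> x \<in> verts (G N) \<Longrightarrow>
           inverse c_tilde \<le> vweight (G N) x \<and> vweight (G N) x \<le> c_tilde"
  shows "\<exists>(c1::real) > 0. \<exists>N1 \<ge> (1::nat). \<forall>t::nat. \<forall>N \<ge> N1.
    (MAX a \<in> lamp_states (G N).
       tv_dist (lamp_states (G N)) (lamp_law (G N) t a) (lamp_stationary (G N)))
    \<ge> inverse c1 * exp (- c1 * real t / real (gdiam (G N)) powr d_w)
       - c_tilde * c_v * real (gdiam (G N)) powr (- d_f)"
proof -
  have cv: "c_v > 0" and diam: "filterlim (\<lambda>N. gdiam (G N)) at_top sequentially"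
    using assms(5) by (auto simp: uniform_weight_conditions_def)
  have pos: "vweight (G N) x > 0" if "N \<ge> 1" "x \<in> verts (G N)" for N x
  proof -
    have "0 < inverse c_tilde" using assms(7) by simp
    also have "\<dots> \<le> vweight (G N) x" using assms(8)[OF that] by simp
    finally show ?thesis .
  qed
  obtain \<kappa> where \<kappa>: "0 < \<kappa>" "\<kappa> \<le> 1" and
    PHI: "\<And>c. c > 0 \<Longrightarrow> \<exists>C > 0.
         \<forall>N\<ge>1. \<forall>x0\<in>verts (G N). \<forall>R T :: real.
           1 \<le> R \<and> R \<le> \<kappa> * real (gdiam (G N)) \<and> 2 * R \<le> T \<and>
           inverse c * R powr d_w \<le> T \<and> T \<le> c * R powr d_w \<longrightarrow>
           (\<forall>u :: nat \<Rightarrow> 'a \<Rightarrow> real.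
             (\<forall>t. \<forall>x\<in>verts (G N). u t x \<ge> 0) \<and>
             caloric_on (G N) (4 * T) (gball (G N) x0 (2 * R)) u \<longrightarrow>
             (MAX (z, s) \<in> gball (G N) x0 R \<times> {s. T \<le> real s \<and> real s \<le> 2 * T}. u s z)
             \<le> C * (MIN (z, s) \<in> gball (G N) x0 R \<times> {s. 3 * T \<le> real s \<and> real s \<le> 4 * T}.
                      u s z + u (s + 1) z))"
    using assms(6) unfolding UPHI_def by blast
  \<comment> \<open>For the diameter \<open>D\<close>, the radius \<open>R = \<kappa> D / 4\<close> and the time \<open>T = D powr d_w\<close>, this is
    the ratio of \<open>T\<close> to \<open>R powr d_w\<close>.\<close>
  define c where "c = (4 / \<kappa>) powr d_w"
  have c: "c \<ge> 1" using \<kappa> assms(2) unfolding c_def by (intro ge_one_powr_ge_zero) auto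
  obtain C where C: "C > 0" and
    Harnack: "\<And>N x0 R T u. N \<ge> 1 \<Longrightarrow> x0 \<in> verts (G N) \<Longrightarrow> 1 \<le> R \<Longrightarrow>
      R \<le> \<kappa> * real (gdiam (G N)) \<Longrightarrow> 2 * R \<le> T \<Longrightarrow> inverse c * R powr d_w \<le> T \<Longrightarrow>
      T \<le> c * R powr d_w \<Longrightarrow>
      (\<forall>t. \<forall>x\<in>verts (G N). u t x \<ge> 0) \<and>
      caloric_on (G N) (4 * T) (gball (G N) x0 (2 * R)) u \<Longrightarrow>
      (MAX (z, s) \<in> gball (G N) x0 R \<times> {s. T \<le> real s \<and> real s \<le> 2 * T}. u s z)
        \<le> C * (MIN (z, s) \<in> gball (G N) x0 R \<times> {s. 3 * T \<le> real s \<and> real s \<le> 4 * T}.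
                      u s z + u (s + 1) z)"
    using PHI[of c] c by (auto 0 0)
  define L where "L = max 1 (2 * C)"
  have L: "L \<ge> 1" "L \<ge> 2 * C" by (auto simp: L_def)
  \<comment> \<open>The factor \<open>1 / 2\<close> comes from \<open>tv_dist_ge\<close>, one factor \<open>L\<close> from the survival estimate
    and another one from the additional time unit in \<open>Suc t\<close>.\<close>
  define c1 where "c1 = 2 * L ^ 2"
  have c1: "c1 > 0" using L by (simp add: c1_def)
  have lnL: "ln L \<le> c1"
  proof -
    have "ln L \<le> L" using L ln_less_self[of L] by linarith
    also have "L \<le> L ^ 2" using L power_increasing[of 1 2 L] by simp
    also have "\<dots> \<le> c1" using L by (simp add: c1_def)
    finally show ?thesis .
  qed
  have "eventually (\<lambda>D::nat. 4 / \<kappa> \<le> real D) sequentially"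
    by real_asymp
  moreover have "eventually (\<lambda>D::nat. 2 powr (- (real D / 2)) / 2
      \<le> c_tilde * c_v * real D powr (- d_f)) sequentially"
    using assms(1,7) cv by real_asymp
  ultimately have "eventually (\<lambda>D::nat. 4 / \<kappa> \<le> real D \<and>
      2 powr (- (real D / 2)) / 2 \<le> c_tilde * c_v * real D powr (- d_f)) sequentially"
    by (rule eventually_conj)
  then have "eventually (\<lambda>N. 4 / \<kappa> \<le> real (gdiam (G N)) \<and>
      2 powr (- (real (gdiam (G N)) / 2)) / 2
        \<le> c_tilde * c_v * real (gdiam (G N)) powr (- d_f)) sequentially"
    by (rule eventually_compose_filterlim[OF _ diam])
  then obtain N0 where N0: "\<And>N. N \<ge> N0 \<Longrightarrow> 4 / \<kappa> \<le> real (gdiam (G N))"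
    "\<And>N. N \<ge> N0 \<Longrightarrow> 2 powr (- (real (gdiam (G N)) / 2)) / 2
        \<le> c_tilde * c_v * real (gdiam (G N)) powr (- d_f)"
    unfolding eventually_sequentially by blast
  show ?thesis
  proof (intro exI[of _ c1] conjI c1 exI[of _ "max 1 N0"] allI impI)
    fix t N :: nat assume "N \<ge> max 1 N0"
    then have N: "N \<ge> 1" "N \<ge> N0" by auto
    define D where "D = real (gdiam (G N))"
    define R where "R = \<kappa> * D / 4"
    define T where "T = D powr d_w"
    note GN = assms(3)[OF N(1)]
    have D: "4 / \<kappa> \<le> D" using N0(1)[OF N(2)] by (simp add: D_def)
    have R1: "1 \<le> R" using D \<kappa> by (simp add: R_def field_simps)
    have D1: "1 \<le> D"
    proof -
      have "1 \<le> 4 / \<kappa>" using \<kappa> by simp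
      with D show ?thesis by linarith
    qed
    have RD: "2 * R \<le> D / 2" using \<kappa> D1 by (simp add: R_def)
    have DT: "D \<le> T" using powr_mono[of 1 d_w D] D1 assms(2) by (simp add: T_def)
    have Rc: "T = c * R powr d_w"
      using \<kappa> D1 by (simp add: T_def c_def R_def flip: powr_mult)
    obtain x y where x: "x \<in> verts (G N)" and y: "y \<in> verts (G N)"
      and xy: "gdist (G N) x y = gdiam (G N)"
      using gdiam_attained[OF GN] .
    define B where "B = gball (G N) x (2 * R)"
    have BV: "B \<subseteq> verts (G N)" by (auto simp: B_def gball_def)
    have xB: "x \<in> B" using x R1 by (simp add: B_def center_in_gball)
    have "survival (G N) B (Suc t) x \<ge> inverse L * exp (- ln L * real (Suc t) / T)"
      unfolding B_def
    proof (rule survival_ge_of_Harnack[OF GN x pos[OF N(1)], where C = C])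
      fix u :: "nat \<Rightarrow> 'a \<Rightarrow> real"
      assume u: "(\<forall>t. \<forall>x\<in>verts (G N). u t x \<ge> 0) \<and>
        caloric_on (G N) (4 * T) (gball (G N) x (2 * R)) u"
      have "inverse c * R powr d_w \<le> c * R powr d_w"
        using c by (intro mult_right_mono) (auto intro: order_trans[of _ 1] simp: inverse_le_1_iff)
      with u show "(MAX (z, s) \<in> gball (G N) x R \<times> {s. T \<le> real s \<and> real s \<le> 2 * T}. u s z)
        \<le> C * (MIN (z, s) \<in> gball (G N) x R \<times> {s. 3 * T \<le> real s \<and> real s \<le> 4 * T}.
                      u s z + u (s + 1) z)"
        using R1 RD DT D1 Rc \<kappa> by (intro Harnack N x) (auto simp: R_def D_def)
    qed (use R1 D1 DT C L in auto)
    also have "inverse L * exp (- ln L * real (Suc t) / T)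
        \<ge> inverse (L ^ 2) * exp (- c1 * real t / T)"
    proof -
      have "ln L * real (Suc t) / T = ln L * real t / T + ln L / T"
        by (simp add: algebra_simps add_divide_distrib)
      also have "\<dots> \<le> c1 * real t / T + ln L"
      proof (rule add_mono)
        show "ln L * real t / T \<le> c1 * real t / T"
          using lnL D1 DT by (intro divide_right_mono mult_right_mono) auto
        show "ln L / T \<le> ln L" using L D1 DT by (simp add: divide_le_eq mult_le_cancel_left1)
      qed
      finally have le: "exp (- c1 * real t / T - ln L) \<le> exp (- ln L * real (Suc t) / T)"
        by simp
      have eq: "exp (- c1 * real t / T - ln L) = exp (- c1 * real t / T) * inverse L"
        using L by (simp add: exp_diff divide_inverse)
      have "inverse L * (exp (- c1 * real t / T) * inverse L)
          \<le> inverse L * exp (- ln L * real (Suc t) / T)"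
        using le[unfolded eq] L by (intro mult_left_mono) auto
      then show ?thesis by (simp add: power2_eq_square ac_simps)
    qed
    finally have surv: "inverse (L ^ 2) * exp (- c1 * real t / T) \<le> survival (G N) B (Suc t) x" .
    have out: "inverse (2 ^ card (verts (G N) - B)) \<le> 2 powr (- (D / 2))"
    proof -
      have "D / 2 \<le> real (card (verts (G N) - B))"
        using card_outside_half_ball[OF GN x y xy, of "2 * R"] RD by (simp add: B_def D_def)
      then have "2 powr (- real (card (verts (G N) - B))) \<le> 2 powr (- (D / 2))"
        by (intro powr_mono) auto
      then show ?thesis by (simp add: powr_minus powr_realpow)
    qed
    have "inverse c1 * exp (- c1 * real t / T) - c_tilde * c_v * D powr (- d_f)
        \<le> inverse c1 * exp (- c1 * real t / T) - 2 powr (- (D / 2)) / 2"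
      using N0(2)[OF N(2)] by (simp add: D_def)
    also have "\<dots> = (inverse (L ^ 2) * exp (- c1 * real t / T) - 2 powr (- (D / 2))) / 2"
      by (simp add: c1_def)
    also have "\<dots> \<le> (survival (G N) B (Suc t) x - inverse (2 ^ card (verts (G N) - B))) / 2"
      using surv out by (intro divide_right_mono diff_mono) auto
    also have "\<dots> \<le> (MAX a \<in> lamp_states (G N).
       tv_dist (lamp_states (G N)) (lamp_law (G N) t a) (lamp_stationary (G N)))"
      by (rule Max_tv_dist_ge_survival[OF GN BV pos[OF N(1)] xB])
    finally show "(MAX a \<in> lamp_states (G N).
       tv_dist (lamp_states (G N)) (lamp_law (G N) t a) (lamp_stationary (G N)))
      \<ge> inverse c1 * exp (- c1 * real t / real (gdiam (G N)) powr d_w)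
       - c_tilde * c_v * real (gdiam (G N)) powr (- d_f)"
      by (simp add: T_def D_def)
  qed simp
qed

end
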